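(* Let $(g_h^n)_{n\ge0}\subset V^h$ satisfy the $Q^k$ finite element scheme $$(\mathcal M g_h^{n+1},\phi_h)+\Delta t\,(D\mathcal M\nabla g_h^{n+1},\nabla\phi_h)+\Delta t\,(\vec u\,g_h^{n+1},\nabla\phi_h)=(\mathcal M g_h^n,\phi_h)\qquad\forall\phi_h\in V^h,$$ and set $\rho_h^n=\mathcal M g_h^n$. Then for any $n\ge0$ the following two inequalities hold: $$\frac1{\Delta t}\int_\Omega\frac{(\rho_h^{n+1})^2}{\mathcal M}-\frac1{\Delta t}\int_\Omega\frac{(\rho_h^{n})^2}{\mathcal M}\le-2D\int_\Omega\mathcal M\Big|\nabla\frac{\rho_h^{n+1}}{\mathcal M}\Big|^2,$$ $$\frac1{\Delta t}\int_\Omega\frac{(\rho_h^{n+1}-\mathcal M)^2}{\mathcal M}-\frac1{\Delta t}\int_\Omega\frac{(\rho_h^{n}-\mathcal M)^2}{\mathcal M}\le-2D\int_\Omega\mathcal M\Big|\nabla\frac{\rho_h^{n+1}}{\mathcal M}\Big|^2.$$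
   Context: $\Omega\subset\mathbb R^d$ ($d=1$ or $2$) is a bounded rectangular domain with outward unit normal $\vec n$; $D>0$ is a constant; $\Delta t>0$; $\mathcal M\in C^1(\bar\Omega)$ is a given function with $\mathcal M\ge\epsilon_0>0$ and $\int_\Omega\mathcal M=1$ (the invariant measure); $\vec u$ is a given time-independent continuously differentiable vector field with $\nabla\cdot\vec u=0$ in $\Omega$ and $\vec u\cdot\vec n=0$ on $\partial\Omega$. $\mathcal E_h$ is a uniform rectangular partition of $\Omega$; for an integer $k\ge1$, $V^h=\{v_h\in C(\Omega): v_h|_E\in\mathbb Q^k(E)\ \forall E\in\mathcal E_h\}\subset H^1(\Omega)$, where $\mathbb Q^k(E)$ is the space of polynomials on $E$ of degree at most $k$ in each variable. $(\cdot,\cdot)$ is the $L^2(\Omega)$ inner product. *)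

theory Defs
  imports "HOL-Analysis.Analysis"
begin

text \<open>
  The domain is the open box \<^term>\<open>box a b\<close> in \<^typ>\<open>real^'d\<close>.
\<close>

definition C1_closure :: "'a::euclidean_space set \<Rightarrow> ('a \<Rightarrow> 'b::real_normed_vector) \<Rightarrow> bool" where
  "C1_closure S f \<longleftrightarrow> continuous_on (closure S) f \<and>
     (\<exists>f' :: 'a \<Rightarrow> 'a \<Rightarrow>\<^sub>L 'b. continuous_on (closure S) f' \<and>
        (\<forall>x\<in>S. (f has_derivative blinfun_apply (f' x)) (at x)))"

text \<open>
  Functions in the finite element space are differentiable off the mesh skeleton, which is a
  null set; there the classical gradient below is a representative of their weak gradient in
  \<open>L\<^sup>2\<close>. On the skeleton the value is irrelevant, since gradients only occur under
  Lebesgue integrals.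
\<close>

definition gradient :: "('a::real_inner \<Rightarrow> real) \<Rightarrow> 'a \<Rightarrow> 'a" where
  "gradient f x = (THE D. GDERIV f x :> D)"

definition divergence :: "(real^'d \<Rightarrow> real^'d) \<Rightarrow> real^'d \<Rightarrow> real" where
  "divergence u x = (\<Sum>i\<in>UNIV. frechet_derivative u (at x) (axis i 1) $ i)"

text \<open>
  The normal is defined on the relative interiors of the faces only, i.e. at the boundary points
  of the box where a unique outward unit normal exists (edges and corners are excluded).
\<close>

definition outward_unit_normal :: "real^'d \<Rightarrow> real^'d \<Rightarrow> real^'d \<Rightarrow> real^'d \<Rightarrow> bool" where
  "outward_unit_normal a b x \<nu> \<longleftrightarrow>
     (\<exists>i. (\<forall>j. j \<noteq> i \<longrightarrow> a $ j < x $ j \<and> x $ j < b $ j) \<and>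
          (x $ i = a $ i \<and> \<nu> = - axis i 1 \<or> x $ i = b $ i \<and> \<nu> = axis i 1))"

text \<open>\<open>N i\<close> is the number of cells in direction \<open>i\<close>; the cells are closed.\<close>

definition mesh_node :: "real^'d \<Rightarrow> real^'d \<Rightarrow> ('d \<Rightarrow> nat) \<Rightarrow> ('d \<Rightarrow> nat) \<Rightarrow> real^'d" where
  "mesh_node a b N j = (\<chi> i. a $ i + real (j i) * ((b $ i - a $ i) / real (N i)))"

definition uniform_partition :: "real^'d \<Rightarrow> real^'d \<Rightarrow> ('d \<Rightarrow> nat) \<Rightarrow> (real^'d) set set" where
  "uniform_partition a b N =
     {cbox (mesh_node a b N j) (mesh_node a b N (\<lambda>i. Suc (j i))) | j. \<forall>i. j i < N i}"

definition Qk :: "nat \<Rightarrow> (real^'d \<Rightarrow> real) set" where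
  "Qk k = {p. \<exists>c :: ('d \<Rightarrow> nat) \<Rightarrow> real.
     \<forall>x. p x = (\<Sum>\<alpha> | \<forall>i. \<alpha> i \<le> k. c \<alpha> * (\<Prod>i\<in>UNIV. x $ i ^ \<alpha> i))}"

definition fe_space :: "real^'d \<Rightarrow> real^'d \<Rightarrow> ('d \<Rightarrow> nat) \<Rightarrow> nat \<Rightarrow> (real^'d \<Rightarrow> real) set" where
  "fe_space a b N k = {v. continuous_on (cbox a b) v \<and>
     (\<forall>E\<in>uniform_partition a b N. \<exists>p\<in>Qk k. \<forall>x\<in>E. v x = p x)}"

definition L2_inner ::
    "'a::euclidean_space set \<Rightarrow> ('a \<Rightarrow> 'b::real_inner) \<Rightarrow> ('a \<Rightarrow> 'b) \<Rightarrow> real" where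
  "L2_inner S f g = (LINT x:S|lebesgue. f x \<bullet> g x)"

end

theory Submission
  imports Defs
begin

text \<open>
  Testing the scheme with \<open>g\<^sub>h\<^sup>n\<^sup>+\<^sup>1\<close> kills the convection term, and \<open>2 x y \<le> x\<^sup>2 + y\<^sup>2\<close> gives the
  first inequality; testing with \<open>1\<close> shows that mass is conserved, so the second inequality is
  the first one up to equal terms.

  The divergence theorem behind the vanishing convection term avoids Fubini. For \<open>F\<close>
  Lipschitz on the closed box and zero on the two faces orthogonal to \<open>e\<close>, the extension
  of \<open>F\<close> by zero is Lipschitz in direction \<open>e\<close> on the whole space. Its difference quotients in this
  direction have integral zero by translation invariance and converge dominatedly to the partial
  derivative, which therefore has integral zero.
\<close>

section \<open>Directional derivatives with integral zero on a box\<close>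

lemma integral_lborel_translation:
  fixes f :: "'a::euclidean_space \<Rightarrow> 'b::{banach, second_countable_topology}"
  assumes "integrable lborel f"
  shows "integrable lborel (\<lambda>x. f (x + c))"
    and "(\<integral>x. f (x + c) \<partial>lborel) = (\<integral>x. f x \<partial>lborel)"
proof -
  have [measurable]: "f \<in> borel_measurable borel"
    using borel_measurable_integrable[OF assms] by simp
  have "integrable (distr lborel borel ((+) c)) f"
    using assms by (simp add: lborel_distr_plus)
  then have "integrable lborel (\<lambda>x. f (c + x))"
    by (subst (asm) integrable_distr_eq) auto
  then show "integrable lborel (\<lambda>x. f (x + c))"
    by (simp add: add.commute)
  have "(\<integral>x. f x \<partial>lborel) = (\<integral>x. f x \<partial>distr lborel borel ((+) c))"
    by (simp add: lborel_distr_plus)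
  also have "\<dots> = (\<integral>x. f (c + x) \<partial>lborel)"
    by (subst integral_distr) auto
  finally show "(\<integral>x. f (x + c) \<partial>lborel) = (\<integral>x. f x \<partial>lborel)"
    by (simp add: add.commute)
qed

text \<open>The Lipschitz bound and the bounded support dominate all difference quotients by a
  multiple of the indicator of one ball. Integrability of \<open>G'\<close> is part of what
  dominated convergence for the gauge integral delivers.\<close>

lemma has_integral_directional_derivative_eq_0:
  fixes G G' :: "'a::euclidean_space \<Rightarrow> real"
  assumes int: "integrable lborel G"
    and S: "bounded S" "\<And>x. x \<notin> S \<Longrightarrow> G x = 0"
    and lip: "\<And>x t. \<bar>G (x + t *\<^sub>R e) - G x\<bar> \<le> L * \<bar>t\<bar>"
    and T: "negligible T"
    and deriv: "\<And>x. x \<notin> T \<Longrightarrow> ((\<lambda>t. G (x + t *\<^sub>R e)) has_real_derivative G' x) (at 0)"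
  shows "(G' has_integral 0) UNIV"
proof -
  obtain R where R: "\<And>x. x \<in> S \<Longrightarrow> norm x \<le> R"
    using S(1) bounded_iff by blast
  define \<tau> where "\<tau> k = inverse (real (Suc k))" for k
  have \<tau>: "\<tau> k > 0" "\<tau> k \<le> 1" for k
    by (simp_all add: \<tau>_def inverse_le_1_iff)
  have \<tau>0: "\<tau> \<longlonglongrightarrow> 0"
    unfolding \<tau>_def by (rule LIMSEQ_inverse_real_of_nat)
  define q where "q k x = (G (x + \<tau> k *\<^sub>R e) - G x) / \<tau> k" for k x
  \<comment> \<open>Steps are at most 1, so a shift moves a point by at most \<open>norm e\<close>;
    outside this ball both terms of every quotient \<open>q k x\<close> vanish.\<close>
  define K :: "'a set" where "K = cball 0 (R + norm e)"
  have L: "L \<ge> 0"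
    using lip[of undefined 1] by auto
  have q_int: "(q k has_integral 0) UNIV" for k
  proof -
    have "integrable lborel (q k)"
      unfolding q_def by (intro integrable_divide_zero Bochner_Integration.integrable_diff
          integral_lborel_translation int)
    moreover have "integral\<^sup>L lborel (q k) = 0"
      unfolding q_def
      by (simp add: Bochner_Integration.integral_diff integral_lborel_translation int)
    ultimately show ?thesis
      using has_integral_integral_lborel by metis
  qed
  have q_le: "norm (q k x) \<le> indicator K x * L" for k x
  proof (cases "x \<in> K")
    case True
    have "\<bar>G (x + \<tau> k *\<^sub>R e) - G x\<bar> \<le> L * \<tau> k"
      using lip[of x "\<tau> k"] \<tau>(1)[of k] by simp
    then show ?thesis
      using True \<tau>(1)[of k] by (simp add: q_def field_simps)
  next
    case False
    then have x: "norm x > R + norm e" by (simp add: K_def)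
    have *: "norm (\<tau> k *\<^sub>R e) \<le> norm e"
      using \<tau>[of k] by (simp add: mult_left_le_one_le)
    have "norm (x + \<tau> k *\<^sub>R e) > R"
      using norm_diff_ineq[of x "\<tau> k *\<^sub>R e"] x * by linarith
    moreover have "norm x > R" using x norm_ge_zero[of e] by linarith
    ultimately have "G (x + \<tau> k *\<^sub>R e) = 0" "G x = 0"
      using R S(2) by force+
    then show ?thesis using False by (simp add: q_def)
  qed
  have q_lim: "(\<lambda>k. q k x) \<longlonglongrightarrow> G' x" if "x \<notin> T" for x
  proof -
    have "((\<lambda>t. (G (x + t *\<^sub>R e) - G x) / t) \<longlongrightarrow> G' x) (at 0)"
      using deriv[OF that] by (simp add: DERIV_def)
    moreover have "filterlim \<tau> (at 0) sequentially"
      using \<tau>0 \<tau>(1) by (auto simp: filterlim_at less_imp_neq[symmetric])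
    ultimately show ?thesis
      unfolding q_def by (rule filterlim_compose)
  qed
  have "emeasure lborel K < \<infinity>" "K \<in> sets lborel"
    unfolding K_def by (rule emeasure_bounded_finite) auto
  then have "integrable lborel (\<lambda>x. indicator K x * L)"
    by (intro integrable_mult_left integrable_real_indicator)
  then have h: "(\<lambda>x. indicator K x * L) integrable_on UNIV"
    using has_integral_integral_lborel by blast
  \<comment> \<open>Convergence may fail on \<open>T\<close>. Setting all functions to zero there
    makes it hold everywhere, at the cost of a change on a negligible set.\<close>
  have "((\<lambda>x. if x \<in> T then 0 else G' x) has_integral 0) UNIV"
  proof (rule has_integral_dominated_convergence)
    show "((\<lambda>x. if x \<in> T then 0 else q k x) has_integral 0) UNIV" for k
      by (rule has_integral_spike[OF T _ q_int[of k]]) auto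
    show "\<forall>x\<in>UNIV. norm (if x \<in> T then 0 else q k x) \<le> indicator K x * L" for k
      using q_le L by (auto simp: indicator_def)
  qed (use h q_lim in auto)
  then show ?thesis
    by (rule has_integral_spike[OF T, rotated]) auto
qed

lemma has_derivative_along_line:
  fixes f :: "'a::real_normed_vector \<Rightarrow> real"
  assumes "(f has_derivative f') (at x)"
  shows "((\<lambda>t. f (x + t *\<^sub>R e)) has_real_derivative f' e) (at 0)"
proof -
  have f: "(f has_derivative f') (at (x + 0 *\<^sub>R e))" using assms by simp
  have "((\<lambda>t. f (x + t *\<^sub>R e)) has_derivative (\<lambda>t. f' (t *\<^sub>R e))) (at (0::real))"
    by (rule has_derivative_compose[of "\<lambda>t. x + t *\<^sub>R e" "\<lambda>t. t *\<^sub>R e", OF _ f]) (auto intro!: derivative_eq_intros)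
  moreover have "f' (t *\<^sub>R e) = f' e * t" for t
    using linear_cmul[OF has_derivative_linear[OF assms]] by (simp add: mult.commute)
  ultimately show ?thesis
    by (simp add: has_field_derivative_def)
qed

text \<open>A segment in direction \<open>e\<close> that starts in the open box can leave it only
  through one of the two faces orthogonal to \<open>e\<close>. The other coordinates stay strictly
  inside, so the exit point is in the relative interior of the face, and zero values there suffice
  for the extension by zero to be Lipschitz along \<open>e\<close>.\<close>

lemma has_integral_partial_derivative_box_eq_0:
  fixes f :: "real^'d \<Rightarrow> real"
  assumes lip: "L-lipschitz_on (cbox a b) f"
    and zero: "\<And>x. x \<in> cbox a b \<Longrightarrow> (\<And>j. j \<noteq> i \<Longrightarrow> a $ j < x $ j \<and> x $ j < b $ j) \<Longrightarrow>
                 x $ i = a $ i \<or> x $ i = b $ i \<Longrightarrow> f x = 0"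
    and T: "negligible T"
    and deriv: "\<And>x. x \<in> box a b - T \<Longrightarrow> (f has_derivative f' x) (at x)"
  shows "((\<lambda>x. f' x (axis i 1)) has_integral 0) (box a b)"
proof -
  define e :: "real^'d" where "e = axis i 1"
  have e: "norm e = 1" "e $ i = 1" "\<And>j. j \<noteq> i \<Longrightarrow> e $ j = 0"
    by (auto simp: e_def norm_axis_1) (auto simp: axis_def)
  define G where "G x = indicator (box a b) x *\<^sub>R f x" for x
  have L: "L \<ge> 0" using lip lipschitz_on_nonneg by blast
  have lip1: "\<bar>G (x + t *\<^sub>R e) - G x\<bar> \<le> L * \<bar>t\<bar>" if x: "x \<in> box a b" for x t
  proof (cases "x + t *\<^sub>R e \<in> box a b")
    case True
    then have "dist (f (x + t *\<^sub>R e)) (f x) \<le> L * dist (x + t *\<^sub>R e) x"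
      using x box_subset_cbox[of a b] by (intro lipschitz_onD[OF lip]) auto
    then show ?thesis using True x e by (simp add: G_def dist_norm)
  next
    case False
    have xb: "a $ j < x $ j" "x $ j < b $ j" for j
      using x by (auto simp: mem_box_cart)
    have "x $ i + t \<le> a $ i \<or> b $ i \<le> x $ i + t"
    proof (rule ccontr)
      assume *: "\<not> ?thesis"
      have "a $ j < (x + t *\<^sub>R e) $ j \<and> (x + t *\<^sub>R e) $ j < b $ j" for j
        using * xb[of j] e by (cases "j = i") auto
      then show False using False by (auto simp: mem_box_cart)
    qed
    \<comment> \<open>\<open>s\<close> is the parameter of the exit point: the segment of length
      \<open>\<bar>t\<bar>\<close> passes through the face at \<open>x + s *\<^sub>R e\<close>,
      where \<open>f\<close> is zero.\<close>
    then obtain s where s: "\<bar>s\<bar> \<le> \<bar>t\<bar>" "x $ i + s = a $ i \<or> x $ i + s = b $ i"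
    proof
      assume "x $ i + t \<le> a $ i"
      then show ?thesis using xb[of i] by (intro that[of "a $ i - x $ i"]) auto
    next
      assume "b $ i \<le> x $ i + t"
      then show ?thesis using xb[of i] by (intro that[of "b $ i - x $ i"]) auto
    qed
    let ?y = "x + s *\<^sub>R e"
    have yi: "?y $ i = a $ i \<or> ?y $ i = b $ i" using s e by simp
    have yj: "a $ j < ?y $ j \<and> ?y $ j < b $ j" if "j \<noteq> i" for j
      using that xb e by simp
    have "a $ j \<le> ?y $ j \<and> ?y $ j \<le> b $ j" for j
      using yi yj[of j] xb[of j] by (cases "j = i") auto
    then have y: "?y \<in> cbox a b" by (auto simp: mem_box_cart)
    have "f ?y = 0" using zero y yj yi by blast
    moreover have "dist (f ?y) (f x) \<le> L * dist ?y x"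
      using x y box_subset_cbox[of a b] by (intro lipschitz_onD[OF lip]) auto
    ultimately have "\<bar>f x\<bar> \<le> L * \<bar>s\<bar>" using e by (simp add: dist_norm)
    also have "\<dots> \<le> L * \<bar>t\<bar>" using s L by (simp add: mult_left_mono)
    finally show ?thesis using x False by (simp add: G_def)
  qed
  have lip2: "\<bar>G (x + t *\<^sub>R e) - G x\<bar> \<le> L * \<bar>t\<bar>" for x t
  proof -
    consider "x \<in> box a b" | "x + t *\<^sub>R e \<in> box a b" | "x \<notin> box a b" "x + t *\<^sub>R e \<notin> box a b"
      by blast
    then show ?thesis
    proof cases
      case 2
      \<comment> \<open>The same segment, traversed backwards from its end point inside the
        box.\<close>
      from lip1[OF this, of "-t"] show ?thesis by (simp add: abs_minus_commute)
    qed (use L lip1 in \<open>auto simp: G_def\<close>)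
  qed
  have "integrable lborel (\<lambda>x. indicator (cbox a b) x *\<^sub>R f x)"
    using lip by (intro borel_integrable_compact lipschitz_on_continuous_on) auto
  then have "integrable lborel (\<lambda>x. indicator (box a b) x *\<^sub>R indicator (cbox a b) x *\<^sub>R f x)"
    by (rule integrable_mult_indicator[rotated]) auto
  moreover have "(\<lambda>x. indicator (box a b) x *\<^sub>R indicator (cbox a b) x *\<^sub>R f x) = G"
    using box_subset_cbox[of a b] by (auto simp: G_def fun_eq_iff indicator_def)
  ultimately have int: "integrable lborel G" by simp
  \<comment> \<open>Besides \<open>T\<close>, the boundary of the box is excepted. Every other point
    lies in the open box, where \<open>G\<close> agrees with \<open>f\<close>, or in the open
    exterior, where \<open>G\<close> is locally zero.\<close>
  have der: "((\<lambda>t. G (x + t *\<^sub>R e)) has_real_derivative (if x \<in> box a b then f' x e else 0)) (at 0)"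
    if x: "x \<notin> T \<union> frontier (box a b)" for x
  proof (cases "x \<in> box a b")
    case True
    have "(f has_derivative f' x) (at x)" using deriv True x by blast
    then have "(G has_derivative f' x) (at x)"
      by (rule has_derivative_transform_within_open[of _ _ _ _ "box a b"])
         (use True in \<open>auto simp: G_def open_box\<close>)
    then show ?thesis using True has_derivative_along_line by simp
  next
    case False
    then have *: "x \<in> - closure (box a b)"
      using x by (simp add: frontier_def interior_open open_box)
    have G0: "0 = G y" if "y \<in> - closure (box a b)" for y
    proof -
      have "y \<notin> box a b" using that closure_subset by blast
      then show ?thesis by (simp add: G_def)
    qed
    have "(G has_derivative (\<lambda>_. 0)) (at x)"
      by (rule has_derivative_transform_within_open[OF has_derivative_const _ * G0]) auto
    then show ?thesis using False has_derivative_along_line[of G "\<lambda>_. 0"] by simp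
  qed
  have "negligible (T \<union> frontier (box a b))"
    using T by (intro negligible_Un negligible_convex_frontier) auto
  moreover have "G x = 0" if "x \<notin> box a b" for x
    using that by (simp add: G_def)
  ultimately have "((\<lambda>x. if x \<in> box a b then f' x e else 0) has_integral 0) UNIV"
    using has_integral_directional_derivative_eq_0[OF int bounded_box _ lip2 _ der] by blast
  then show ?thesis by (simp add: e_def)
qed

section \<open>Calculus of Lipschitz functions\<close>

text \<open>Convexity reduces the claim to a segment. The preimages of the pieces form a finite
  closed cover of the unit interval, where Lipschitz bounds glue without loss in the constant. This
  passes from cellwise bounds to the whole box.\<close>

lemma lipschitz_on_closed_cover:
  fixes f :: "'a::real_normed_vector \<Rightarrow> 'b::metric_space"
  assumes "finite I" and closed: "\<And>E. E \<in> I \<Longrightarrow> closed E"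
    and lip: "\<And>E. E \<in> I \<Longrightarrow> L-lipschitz_on E f"
    and S: "convex S" "S \<subseteq> \<Union>I" and L: "L \<ge> 0"
  shows "L-lipschitz_on S f"
proof (rule lipschitz_onI[OF _ L])
  fix x y assume xy: "x \<in> S" "y \<in> S"
  define l where "l t = x + t *\<^sub>R (y - x)" for t :: real
  have l_lip: "(norm (y - x))-lipschitz_on U l" for U
  proof (rule lipschitz_onI)
    fix s t :: real
    have "l s - l t = (s - t) *\<^sub>R (y - x)" by (simp add: l_def algebra_simps)
    then show "dist (l s) (l t) \<le> norm (y - x) * dist s t" by (simp add: dist_norm)
  qed simp
  have l_cont: "continuous_on UNIV l"
    using lipschitz_on_continuous_on[OF l_lip] .
  have "(L * norm (y - x))-lipschitz_on {0..1} (\<lambda>t. f (l t))"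
  proof (rule lipschitz_on_closed_Union[of I _ "\<lambda>E. l -` E"])
    fix E assume E: "E \<in> I"
    show "(L * norm (y - x))-lipschitz_on (l -` E) (\<lambda>t. f (l t))"
      by (rule lipschitz_on_compose2[OF l_lip lipschitz_on_subset[OF lip[OF E]]]) auto
    show "closed (l -` E)"
      using closed[OF E] l_cont by (simp add: closed_vimage)
  next
    have "l t \<in> S" if "t \<in> {0..1}" for t
    proof -
      have "l t = (1 - t) *\<^sub>R x + t *\<^sub>R y" by (simp add: l_def algebra_simps)
      then show ?thesis using S(1) xy that by (simp add: convexD_alt)
    qed
    then show "{0..1} \<subseteq> (\<Union>E\<in>I. l -` E)" using S(2) by blast
  qed (use assms in auto)
  then have "dist (f (l 0)) (f (l 1)) \<le> L * norm (y - x) * dist (0::real) 1"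
    by (rule lipschitz_onD) auto
  then show "dist (f x) (f y) \<le> L * dist x y"
    by (simp add: l_def dist_norm norm_minus_commute)
qed

text \<open>Compactness bounds both factors, so the usual splitting of a difference of products
  gives a finite constant.\<close>

lemma lipschitz_on_mult_compact:
  fixes f g :: "'a::metric_space \<Rightarrow> real"
  assumes K: "compact K" and f: "\<exists>L. L-lipschitz_on K f" and g: "\<exists>L. L-lipschitz_on K g"
  shows "\<exists>L. L-lipschitz_on K (\<lambda>x. f x * g x)"
proof -
  obtain A B where A: "A-lipschitz_on K f" and B: "B-lipschitz_on K g" using f g by blast
  have "bounded (f ` K)" "bounded (g ` K)"
    using A B K by (auto intro!: compact_imp_bounded compact_continuous_image
        lipschitz_on_continuous_on)
  then obtain P Q where P: "\<And>x. x \<in> K \<Longrightarrow> \<bar>f x\<bar> \<le> P" "P > 0"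
      and Q: "\<And>x. x \<in> K \<Longrightarrow> \<bar>g x\<bar> \<le> Q" "Q > 0"
    unfolding bounded_pos by auto
  have AB: "A \<ge> 0" "B \<ge> 0" using A B lipschitz_on_nonneg by blast+
  have "(P * B + A * Q)-lipschitz_on K (\<lambda>x. f x * g x)"
  proof (rule lipschitz_onI)
    fix x y assume xy: "x \<in> K" "y \<in> K"
    have "f x * g x - f y * g y = f x * (g x - g y) + (f x - f y) * g y"
      by (simp add: algebra_simps)
    also have "\<bar>\<dots>\<bar> \<le> \<bar>f x\<bar> * \<bar>g x - g y\<bar> + \<bar>f x - f y\<bar> * \<bar>g y\<bar>"
      using abs_triangle_ineq by (metis abs_mult)
    also have "\<dots> \<le> P * (B * dist x y) + (A * dist x y) * Q"
      using P Q xy AB lipschitz_onD[OF A xy] lipschitz_onD[OF B xy]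
      by (intro add_mono mult_mono) (auto simp: dist_real_def)
    finally show "dist (f x * g x) (f y * g y) \<le> (P * B + A * Q) * dist x y"
      by (simp add: dist_real_def algebra_simps)
  qed (use AB P Q in auto)
  then show ?thesis by blast
qed

lemma lipschitz_on_prod_compact:
  fixes f :: "'i \<Rightarrow> 'a::metric_space \<Rightarrow> real"
  assumes "compact K" and "\<And>i. i \<in> I \<Longrightarrow> \<exists>L. L-lipschitz_on K (f i)"
  shows "\<exists>L. L-lipschitz_on K (\<lambda>x. \<Prod>i\<in>I. f i x)"
  using assms(2)
proof (induction I rule: infinite_finite_induct)
  case (insert i I)
  then show ?case using lipschitz_on_mult_compact[OF assms(1), of "f i"] by simp
qed (auto intro: lipschitz_on_constant)

lemma lipschitz_on_sum:
  fixes f :: "'i \<Rightarrow> 'a::metric_space \<Rightarrow> real"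
  assumes "\<And>i. i \<in> I \<Longrightarrow> \<exists>L. L-lipschitz_on K (f i)"
  shows "\<exists>L. L-lipschitz_on K (\<lambda>x. \<Sum>i\<in>I. f i x)"
  using assms
proof (induction I rule: infinite_finite_induct)
  case (insert i I)
  then obtain A B where "A-lipschitz_on K (f i)" "B-lipschitz_on K (\<lambda>x. \<Sum>i\<in>I. f i x)"
    by fastforce
  from lipschitz_on_add[OF this] show ?case using insert by auto
qed (auto intro: lipschitz_on_constant)

lemma lipschitz_on_component:
  fixes f :: "'a::metric_space \<Rightarrow> real^'d"
  assumes "L-lipschitz_on K f"
  shows "L-lipschitz_on K (\<lambda>x. f x $ i)"
proof (rule lipschitz_onI)
  fix x y assume "x \<in> K" "y \<in> K"
  then have "dist (f x) (f y) \<le> L * dist x y" by (rule lipschitz_onD[OF assms])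
  then show "dist (f x $ i) (f y $ i) \<le> L * dist x y"
    using dist_vec_nth_le[of "f x" i "f y"] by linarith
qed (use assms lipschitz_on_nonneg in blast)

section \<open>Regularity of finite element functions\<close>

text \<open>Coordinates are Lipschitz, and on a compact set this property survives products and
  finite sums.\<close>

lemma Qk_lipschitz_on_compact:
  assumes "p \<in> Qk k" "compact K"
  shows "\<exists>L. L-lipschitz_on K p"
proof -
  obtain c where p: "p = (\<lambda>x. \<Sum>\<alpha> | \<forall>i. \<alpha> i \<le> k. c \<alpha> * (\<Prod>i\<in>UNIV. x $ i ^ \<alpha> i))"
    using assms(1) by (auto simp: Qk_def)
  have "\<exists>L. L-lipschitz_on K (\<lambda>x. x $ i ^ n)" for i n
  proof (induction n)
    case (Suc n)
    have "\<exists>L. L-lipschitz_on K (\<lambda>x. x $ i)"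
      using lipschitz_on_component[OF lipschitz_on_id] by blast
    from lipschitz_on_mult_compact[OF assms(2) this Suc] show ?case by simp
  qed (auto intro: lipschitz_on_constant)
  then show ?thesis
    unfolding p using assms(2)
    by (intro lipschitz_on_sum lipschitz_on_mult_compact lipschitz_on_prod_compact)
       (auto intro: lipschitz_on_constant)
qed

lemma Qk_differentiable:
  assumes "p \<in> Qk k"
  shows "p differentiable (at x)"
proof -
  obtain c where p: "p = (\<lambda>x. \<Sum>\<alpha> | \<forall>i. \<alpha> i \<le> k. c \<alpha> * (\<Prod>i\<in>UNIV. x $ i ^ \<alpha> i))"
    using assms by (auto simp: Qk_def)
  have "(\<lambda>x. x $ i ^ n) differentiable (at x)" for i :: 'a and n
    by (intro differentiable_power bounded_linear_imp_differentiable bounded_linear_vec_nth)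
  \<comment> \<open>The derivatives are chosen as one family, the form in which the product rule
    over all coordinates takes them.\<close>
  then have "\<exists>D. \<forall>i n. ((\<lambda>x. x $ i ^ n) has_derivative D i n) (at x)"
    unfolding differentiable_def by metis
  then obtain D where D: "\<And>i n. ((\<lambda>x. x $ i ^ n) has_derivative D i n) (at x)" by blast
  have "(\<lambda>x. \<Prod>i\<in>UNIV. x $ i ^ \<alpha> i) differentiable (at x)" for \<alpha> :: "'a \<Rightarrow> nat"
    using has_derivative_prod[of UNIV "\<lambda>i x. x $ i ^ \<alpha> i" "\<lambda>i. D i (\<alpha> i)" x UNIV] D
    by (auto simp: differentiable_def)
  moreover have "finite {\<alpha> :: 'a \<Rightarrow> nat. \<forall>i. \<alpha> i \<le> k}"
    using finite_PiE[of UNIV "\<lambda>_::'a. {..k}"] by (simp add: PiE_def Pi_def)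
  ultimately show ?thesis
    unfolding p by (intro differentiable_sum differentiable_mult) auto
qed

text \<open>The constant 1 is the test function that yields conservation of mass. Its only nonzero
  coefficient belongs to the multi-index 0.\<close>

lemma one_in_fe_space: "(\<lambda>x. 1) \<in> fe_space a b N k"
proof -
  have fin: "finite {\<alpha> :: 'a \<Rightarrow> nat. \<forall>i. \<alpha> i \<le> k}"
    using finite_PiE[of UNIV "\<lambda>_::'a. {..k}"] by (simp add: PiE_def Pi_def)
  have "(\<Sum>\<alpha> | \<forall>i::'a. \<alpha> i \<le> k. (if \<alpha> = (\<lambda>_. 0) then 1 else 0) * (\<Prod>i\<in>UNIV. x $ i ^ \<alpha> i)) = (1::real)"
    for x :: "real^'a"
    using fin by (simp add: if_distrib[of "\<lambda>y. y * _"] cong: if_cong)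
  then have "(\<lambda>x::real^'a. 1) \<in> Qk k"
    unfolding Qk_def by (intro CollectI exI[of _ "\<lambda>\<alpha>. if \<alpha> = (\<lambda>_. 0) then 1 else 0"]) simp
  then show ?thesis by (auto simp: fe_space_def)
qed

lemma finite_uniform_partition: "finite (uniform_partition a b N)"
proof -
  have "finite {j :: 'a \<Rightarrow> nat. \<forall>i. j i < N i}"
    using finite_PiE[of UNIV "\<lambda>i::'a. {..<N i}"] by (simp add: PiE_def Pi_def)
  then show ?thesis
    unfolding uniform_partition_def by simp
qed

text \<open>Location of a point in a one-dimensional grid, by induction on the number of cells: the
  point is in one of the first \<open>n\<close> cells or in the last one.\<close>

lemma grid_cell_exists:
  fixes s h :: real
  assumes "n \<ge> 1" "0 \<le> s" "s \<le> real n * h"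
  shows "\<exists>j<n. real j * h \<le> s \<and> s \<le> real (Suc j) * h"
  using assms
proof (induction n)
  case (Suc n)
  show ?case
  proof (cases "n \<ge> 1 \<and> s \<le> real n * h")
    case True
    then show ?thesis using Suc by (meson less_Suc_eq)
  next
    case False
    \<comment> \<open>Here \<open>n = 0\<close> or \<open>s\<close> lies beyond the first
      \<open>n\<close> cells; either way cell \<open>n\<close> contains it.\<close>
    then show ?thesis using Suc.prems by (intro exI[of _ n]) (cases n, auto)
  qed
qed simp

lemma cbox_subset_uniform_partition:
  assumes "\<And>i. N i \<ge> 1"
  shows "cbox a b \<subseteq> \<Union>(uniform_partition a b N)"
proof
  fix x assume "x \<in> cbox a b"
  then have x: "a $ i \<le> x $ i" "x $ i \<le> b $ i" for i by (auto simp: mem_box_cart)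
  have "\<exists>j<N i. real j * ((b $ i - a $ i) / real (N i)) \<le> x $ i - a $ i \<and>
          x $ i - a $ i \<le> real (Suc j) * ((b $ i - a $ i) / real (N i))" for i
    using x[of i] assms[of i] by (intro grid_cell_exists) auto
  then obtain j where j: "\<And>i. j i < N i"
      "\<And>i. real (j i) * ((b $ i - a $ i) / real (N i)) \<le> x $ i - a $ i"
      "\<And>i. x $ i - a $ i \<le> real (Suc (j i)) * ((b $ i - a $ i) / real (N i))"
    by metis
  have "x \<in> cbox (mesh_node a b N j) (mesh_node a b N (\<lambda>i. Suc (j i)))"
    unfolding mem_box_cart mesh_node_def vec_lambda_beta
    using j(2,3) by (auto simp: le_diff_eq diff_le_eq add.commute)
  then show "x \<in> \<Union>(uniform_partition a b N)"
    using j(1) by (auto simp: uniform_partition_def)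
qed

text \<open>On each compact cell the function is a polynomial, hence Lipschitz. There are finitely
  many closed cells, so the cellwise bounds glue over the convex box.\<close>

lemma fe_space_lipschitz:
  assumes N: "\<And>i. N i \<ge> 1" and v: "v \<in> fe_space a b N k"
  shows "\<exists>L. L-lipschitz_on (cbox a b) v"
proof -
  have "\<exists>L. L-lipschitz_on E v" if "E \<in> uniform_partition a b N" for E
  proof -
    have "\<exists>p\<in>Qk k. \<forall>x\<in>E. v x = p x"
      using v that by (simp add: fe_space_def)
    then obtain p where p: "p \<in> Qk k" "\<And>x. x \<in> E \<Longrightarrow> v x = p x" by auto
    have "compact E" using that by (auto simp: uniform_partition_def)
    with p(1) obtain L where "L-lipschitz_on E p" using Qk_lipschitz_on_compact by blast
    then have "L-lipschitz_on E v" by (rule lipschitz_on_transform) (simp add: p(2))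
    then show ?thesis ..
  qed
  then obtain L where L: "\<And>E. E \<in> uniform_partition a b N \<Longrightarrow> (L E)-lipschitz_on E v"
    by metis
  \<comment> \<open>The sum of the absolute values is a nonnegative constant valid on every
    cell.\<close>
  define B where "B = (\<Sum>E\<in>uniform_partition a b N. \<bar>L E\<bar>)"
  have LB: "L E \<le> B" if "E \<in> uniform_partition a b N" for E
    using member_le_sum[of E "uniform_partition a b N" "\<lambda>E. \<bar>L E\<bar>"] that
      finite_uniform_partition[of a b N] by (simp add: B_def)
  have "B-lipschitz_on (cbox a b) v"
  proof (rule lipschitz_on_closed_cover[OF finite_uniform_partition[of a b N]])
    show "closed E" if "E \<in> uniform_partition a b N" for E
      using that by (auto simp: uniform_partition_def)
    show "B-lipschitz_on E v" if "E \<in> uniform_partition a b N" for E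
      using lipschitz_on_mono[OF L[OF that] _ LB[OF that]] by simp
    show "0 \<le> B" by (auto simp: B_def intro: sum_nonneg)
    show "cbox a b \<subseteq> \<Union>(uniform_partition a b N)"
      by (rule cbox_subset_uniform_partition[of N, OF N])
  qed auto
  then show ?thesis by blast
qed

text \<open>The skeleton is a finite union of boundaries of convex sets, hence negligible. Any other
  point is interior to some cell, and near it the function is a polynomial.\<close>

lemma fe_space_differentiable_off_negligible:
  assumes N: "\<And>i. N i \<ge> 1" and v: "v \<in> fe_space a b N k"
  shows "\<exists>T. negligible T \<and> (\<forall>x \<in> box a b - T. v differentiable (at x))"
proof (intro exI conjI ballI)
  let ?T = "\<Union>E\<in>uniform_partition a b N. frontier E"
  show "negligible ?T"
    using finite_uniform_partition[of a b N]
    by (intro negligible_Union) (auto simp: uniform_partition_def intro!: negligible_convex_frontier)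
  fix x assume x: "x \<in> box a b - ?T"
  obtain E where E: "E \<in> uniform_partition a b N" "x \<in> E"
    using x cbox_subset_uniform_partition[of N a b, OF N] box_subset_cbox[of a b] by blast
  then have xE: "x \<in> interior E"
    using x closure_subset by (auto simp: frontier_def)
  obtain p where p: "p \<in> Qk k" "\<And>x. x \<in> E \<Longrightarrow> v x = p x"
    using v E unfolding fe_space_def by blast
  have pv: "p y = v y" if "y \<in> interior E" for y
    using that p(2) interior_subset by fastforce
  obtain D where "(p has_derivative D) (at x)"
    using Qk_differentiable[OF p(1)] by (auto simp: differentiable_def)
  then have "(v has_derivative D) (at x)"
    by (rule has_derivative_transform_within_open[of _ _ _ _ "interior E"])
       (use xE pv in auto)
  then show "v differentiable (at x)" by (auto simp: differentiable_def)
qed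

section \<open>Lipschitz bound for the velocity, classical gradients and the vanishing convection
  term\<close>

text \<open>The derivative extends continuously to the compact closure and is therefore bounded. The
  mean value inequality on the convex set gives the bound, and continuity carries it to the
  closure.\<close>

lemma C1_closure_lipschitz:
  fixes u :: "'a::euclidean_space \<Rightarrow> 'b::real_normed_vector"
  assumes "C1_closure S u" "convex S" "bounded S"
  shows "\<exists>L. L-lipschitz_on (closure S) u"
proof -
  obtain u' where u: "continuous_on (closure S) u" "continuous_on (closure S) u'"
      "\<And>x. x \<in> S \<Longrightarrow> (u has_derivative blinfun_apply (u' x)) (at x)"
    using assms(1) by (auto simp: C1_closure_def)
  have "bounded (u' ` closure S)"
    using u(2) assms(3) by (intro compact_imp_bounded compact_continuous_image) auto
  then obtain B where B: "B > 0" "\<And>x. x \<in> closure S \<Longrightarrow> norm (u' x) \<le> B"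
    unfolding bounded_pos by auto
  have "B-lipschitz_on S u"
  proof (rule bounded_derivative_imp_lipschitz)
    show "(u has_derivative blinfun_apply (u' x)) (at x within S)" if "x \<in> S" for x
      using u(3)[OF that] by (rule has_derivative_at_withinI)
    show "onorm (blinfun_apply (u' x)) \<le> B" if "x \<in> S" for x
      using B(2)[of x] that closure_subset by (auto simp: norm_blinfun.rep_eq)
  qed (use assms B in auto)
  then show ?thesis using u(1) lipschitz_on_closure by blast
qed

text \<open>Riesz representation in coordinates: \<open>D\<close> represents the derivative, and
  uniqueness of derivatives makes the definite description pick it.\<close>

lemma gradient_inner:
  fixes f :: "'a::euclidean_space \<Rightarrow> real"
  assumes "(f has_derivative f') (at x)"
  shows "f' h = h \<bullet> gradient f x"
proof -
  define D where "D = (\<Sum>e\<in>Basis. f' e *\<^sub>R e)"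
  have f': "f' = (\<lambda>h. h \<bullet> D)"
  proof
    fix h
    have "f' h = f' (\<Sum>e\<in>Basis. (h \<bullet> e) *\<^sub>R e)" by (simp add: euclidean_representation)
    also have "\<dots> = (\<Sum>e\<in>Basis. (h \<bullet> e) * f' e)"
      using has_derivative_linear[OF assms] by (simp add: linear_sum linear_cmul)
    also have "\<dots> = h \<bullet> D" by (simp add: D_def inner_sum_right mult.commute)
    finally show "f' h = h \<bullet> D" .
  qed
  have "gradient f x = D"
    unfolding gradient_def
  proof (rule the_equality)
    show "GDERIV f x :> D" using assms f' by (simp add: gderiv_def)
    fix E assume "GDERIV f x :> E"
    then have "(\<lambda>h. h \<bullet> E) = (\<lambda>h. h \<bullet> D)"
      using assms f' has_derivative_unique unfolding gderiv_def by blast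
    from fun_cong[OF this, of "E - D"] have "(E - D) \<bullet> (E - D) = 0"
      by (simp add: inner_diff_right)
    then show "E = D" by simp
  qed
  then show ?thesis using f' by simp
qed

lemma gradient_const: "gradient (\<lambda>x::'a::euclidean_space. c) x = 0"
proof -
  have "h \<bullet> gradient (\<lambda>x::'a. c) x = 0" for h
    using gradient_inner[of "\<lambda>_. c" "\<lambda>_. 0" x h] by simp
  from this[of "gradient (\<lambda>x::'a. c) x"] show ?thesis by simp
qed

text \<open>Derivatives are local, so the two definite descriptions range over equivalent
  predicates. The equality thus holds even at points where no gradient exists.\<close>

lemma gradient_cong_open:
  assumes "open S" "x \<in> S" "\<And>y. y \<in> S \<Longrightarrow> f y = g y"
  shows "gradient f x = gradient g x"
proof -
  have "GDERIV f x :> D \<longleftrightarrow> GDERIV g x :> D" for D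
    unfolding gderiv_def
    by (rule iffI; erule has_derivative_transform_within_open[OF _ assms(1,2)]) (simp_all add: assms(3))
  then show ?thesis by (simp add: gradient_def)
qed

text \<open>A Henstock--Kurzweil integrable function that is not Lebesgue integrable has the junk
  value \<open>0\<close> as its Lebesgue integral, so absolute integrability is not needed here.\<close>

lemma set_lebesgue_integral_eq_0:
  fixes f :: "'a::euclidean_space \<Rightarrow> real"
  assumes "(f has_integral 0) S"
  shows "(LINT x:S|lebesgue. f x) = 0"
proof (cases "set_integrable lebesgue S f")
  case True
  then show ?thesis using set_lebesgue_integral_eq_integral(2)[OF True] integral_unique[OF assms] by simp
next
  case False
  then show ?thesis
    by (simp add: set_integrable_def set_lebesgue_integral_def not_integrable_integral_eq)
qed

text \<open>Since \<open>v u \<bullet> \<nabla>v = div (v\<^sup>2 u) / 2\<close> off the skeleton, this is the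
  divergence theorem for \<open>v\<^sup>2 u\<close>, applied one direction at a time.\<close>

lemma convection_skew:
  fixes a b :: "real^'d"
  assumes ab: "\<And>i. a $ i < b $ i"
    and u: "C1_closure (box a b) u"
    and div: "\<And>x. x \<in> box a b \<Longrightarrow> divergence u x = 0"
    and normal: "\<And>x \<nu>. x \<in> frontier (box a b) \<Longrightarrow> outward_unit_normal a b x \<nu> \<Longrightarrow> u x \<bullet> \<nu> = 0"
    and N: "\<And>i. N i \<ge> 1" and v: "v \<in> fe_space a b N k"
  shows "L2_inner (box a b) (\<lambda>x. v x *\<^sub>R u x) (gradient v) = 0"
proof -
  have cl: "closure (box a b) = cbox a b"
    using ab by (intro closure_box) (simp add: interval_ne_empty_cart)
  obtain T where T: "negligible T" "\<And>x. x \<in> box a b - T \<Longrightarrow> v differentiable (at x)"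
    using fe_space_differentiable_off_negligible[where N = N, OF N v] by blast
  define v' where "v' x = frechet_derivative v (at x)" for x
  have v': "(v has_derivative v' x) (at x)" if "x \<in> box a b - T" for x
    using T(2)[OF that] by (simp add: v'_def flip: frechet_derivative_works)
  \<comment> \<open>The derivative is taken as \<open>frechet_derivative\<close> because
    \<open>divergence\<close> is defined through it.\<close>
  define u' where "u' x = frechet_derivative u (at x)" for x
  have u': "(u has_derivative u' x) (at x)" if "x \<in> box a b" for x
    using u that unfolding u'_def C1_closure_def
    by (meson differentiableI frechet_derivative_works)
  obtain Lu where Lu: "Lu-lipschitz_on (cbox a b) u"
    using C1_closure_lipschitz[OF u] cl by auto
  \<comment> \<open>\<open>f i\<close> is the \<open>i\<close>-th component of the flux
    \<open>v\<^sup>2 u\<close>; \<open>f'\<close> is its derivative in the shape produced by the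
    product rule.\<close>
  define f where "f i = (\<lambda>x. v x * v x * u x $ i)" for i
  define f' where "f' i x = (\<lambda>h. v x * v x * u' x h $ i + (v x * v' x h + v' x h * v x) * u x $ i)"
    for i x
  have f': "(f i has_derivative f' i x) (at x)" if "x \<in> box a b - T" for i x
  proof -
    have "((\<lambda>x. u x $ i) has_derivative (\<lambda>h. u' x h $ i)) (at x)"
      using bounded_linear.has_derivative[OF bounded_linear_vec_nth u'] that by blast
    from has_derivative_mult[OF has_derivative_mult[OF v'[OF that] v'[OF that]] this]
    show ?thesis
      unfolding f_def f'_def .
  qed
  have zero: "f i x = 0"
    if x: "x \<in> cbox a b" and xj: "\<And>j. j \<noteq> i \<Longrightarrow> a $ j < x $ j \<and> x $ j < b $ j"
      and xi: "x $ i = a $ i \<or> x $ i = b $ i" for i x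
  proof -
    have "x \<notin> box a b" using xi by (auto simp: mem_box_cart intro!: exI[of _ i])
    then have "x \<in> frontier (box a b)" using x by (simp add: frontier_def cl interior_open open_box)
    \<comment> \<open>In the relative interior of the face the outward normal is plus or minus the
      \<open>i\<close>-th axis, so the boundary condition says that the \<open>i\<close>-th
      component of \<open>u\<close> vanishes.\<close>
    moreover obtain \<nu> where \<nu>: "outward_unit_normal a b x \<nu>" "\<nu> = axis i 1 \<or> \<nu> = - axis i 1"
      using xj xi unfolding outward_unit_normal_def by blast
    ultimately have "u x \<bullet> \<nu> = 0" using normal by blast
    then have "u x $ i = 0" using \<nu>(2) by (auto simp: inner_axis)
    then show ?thesis by (simp add: f_def)
  qed
  have "((\<lambda>x. f' i x (axis i 1)) has_integral 0) (box a b)" for i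
  proof -
    have "\<exists>L. L-lipschitz_on (cbox a b) (f i)"
      unfolding f_def
      using fe_space_lipschitz[where N = N, OF N v] lipschitz_on_component[OF Lu]
      by (intro lipschitz_on_mult_compact) auto
    then obtain L where "L-lipschitz_on (cbox a b) (f i)" ..
    then show ?thesis
      by (rule has_integral_partial_derivative_box_eq_0[OF _ zero T(1) f'])
  qed
  then have "((\<lambda>x. \<Sum>i\<in>UNIV. f' i x (axis i 1)) has_integral (\<Sum>i\<in>(UNIV::'d set). 0)) (box a b)"
    by (intro has_integral_sum) auto
  then have sum: "((\<lambda>x. \<Sum>i\<in>UNIV. f' i x (axis i 1)) has_integral 0) (box a b)" by simp
  \<comment> \<open>The divergence of the flux is
    \<open>2 v u \<bullet> \<nabla>v + v\<^sup>2 div u\<close>, and \<open>u\<close> is divergence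
    free.\<close>
  have eq: "(\<Sum>i\<in>UNIV. f' i x (axis i 1)) = 2 * ((v x *\<^sub>R u x) \<bullet> gradient v x)"
    if x: "x \<in> box a b - T" for x
  proof -
    have "v' x (axis i 1) = gradient v x $ i" for i
      using gradient_inner[OF v'[OF x]] by (simp add: inner_axis inner_commute)
    then have "(\<Sum>i\<in>UNIV. f' i x (axis i 1)) =
        2 * v x * (\<Sum>i\<in>UNIV. u x $ i * gradient v x $ i) + v x * v x * (\<Sum>i\<in>UNIV. u' x (axis i 1) $ i)"
      by (simp add: f'_def sum_distrib_left sum.distrib algebra_simps)
    also have "(\<Sum>i\<in>UNIV. u' x (axis i 1) $ i) = divergence u x"
      by (simp add: divergence_def u'_def)
    finally show ?thesis using div x by (simp add: inner_vec_def sum_distrib_left mult.assoc)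
  qed
  have "((\<lambda>x. 2 * ((v x *\<^sub>R u x) \<bullet> gradient v x)) has_integral 0) (box a b)"
    by (rule has_integral_spike[OF T(1) eq[symmetric] sum])
  then have "(LINT x:box a b|lebesgue. 2 * ((v x *\<^sub>R u x) \<bullet> gradient v x)) = 0"
    by (rule set_lebesgue_integral_eq_0)
  then show ?thesis by (simp add: L2_inner_def)
qed

section \<open>Energy inequalities for the scheme\<close>

theorem proposition2p3:
  fixes a b :: "real^'d"
    and D \<Delta>t \<epsilon>\<^sub>0 :: real
    and M :: "real^'d \<Rightarrow> real"
    and u :: "real^'d \<Rightarrow> real^'d"
    and N :: "'d \<Rightarrow> nat"
    and k :: nat
    and g \<rho> :: "nat \<Rightarrow> real^'d \<Rightarrow> real"
  assumes "CARD('d) = 1 \<or> CARD('d) = 2"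
    and "\<And>i. a $ i < b $ i"
    and "D > 0" and "\<Delta>t > 0" and "\<epsilon>\<^sub>0 > 0"
    and "C1_closure (box a b) M"
    and "\<And>x. x \<in> cbox a b \<Longrightarrow> M x \<ge> \<epsilon>\<^sub>0"
    and "(LINT x:box a b|lebesgue. M x) = 1"
    and "C1_closure (box a b) u"
    and "\<And>x. x \<in> box a b \<Longrightarrow> divergence u x = 0"
    and "\<And>x \<nu>. x \<in> frontier (box a b) \<Longrightarrow> outward_unit_normal a b x \<nu> \<Longrightarrow> u x \<bullet> \<nu> = 0"
    and "\<And>i. N i \<ge> 1" and "k \<ge> 1"
    and "\<And>n. g n \<in> fe_space a b N k"
    and "\<And>n \<phi>. \<phi> \<in> fe_space a b N k \<Longrightarrow>
           L2_inner (box a b) (\<lambda>x. M x * g (Suc n) x) \<phi>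
           + \<Delta>t * L2_inner (box a b) (\<lambda>x. (D * M x) *\<^sub>R gradient (g (Suc n)) x) (gradient \<phi>)
           + \<Delta>t * L2_inner (box a b) (\<lambda>x. g (Suc n) x *\<^sub>R u x) (gradient \<phi>)
           = L2_inner (box a b) (\<lambda>x. M x * g n x) \<phi>"
    and "\<And>n x. \<rho> n x = M x * g n x"
  shows "\<forall>n.
    1 / \<Delta>t * (LINT x:box a b|lebesgue. (\<rho> (Suc n) x)\<^sup>2 / M x)
      - 1 / \<Delta>t * (LINT x:box a b|lebesgue. (\<rho> n x)\<^sup>2 / M x)
      \<le> - 2 * D * (LINT x:box a b|lebesgue.
            M x * (norm (gradient (\<lambda>y. \<rho> (Suc n) y / M y) x))\<^sup>2)
    \<and>
    1 / \<Delta>t * (LINT x:box a b|lebesgue. (\<rho> (Suc n) x - M x)\<^sup>2 / M x)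
      - 1 / \<Delta>t * (LINT x:box a b|lebesgue. (\<rho> n x - M x)\<^sup>2 / M x)
      \<le> - 2 * D * (LINT x:box a b|lebesgue.
            M x * (norm (gradient (\<lambda>y. \<rho> (Suc n) y / M y) x))\<^sup>2)"
proof (intro allI)
  fix n
  note scheme = assms(15) and \<rho> = assms(16)
  define S where "S = box a b"
  define v w where "v = g (Suc n)" and "w = g n"
  have "closure S = cbox a b"
    unfolding S_def using assms(2) by (intro closure_box) (simp add: interval_ne_empty_cart)
  with assms(6) have M: "continuous_on (cbox a b) M" by (simp add: C1_closure_def S_def)
  have Mpos: "M x > 0" if "x \<in> S" for x
    using assms(5,7) box_subset_cbox[of a b] that by (force simp: S_def)
  have S: "S \<in> sets lebesgue" "open S" by (simp_all add: S_def open_box)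
  have cont: "continuous_on (cbox a b) v" "continuous_on (cbox a b) w"
    using assms(14) unfolding fe_space_def v_def w_def by blast+
  \<comment> \<open>Continuity on the compact closed box gives integrability there, which restricts
    to the open box.\<close>
  have int: "set_integrable lebesgue S f" if "continuous_on (cbox a b) f" for f :: "real^'d \<Rightarrow> real"
    by (rule set_integrable_subset[OF absolutely_integrable_continuous[OF that] S(1)])
       (simp add: S_def box_subset_cbox)
  have ints: "set_integrable lebesgue S M" "set_integrable lebesgue S (\<lambda>x. M x * v x)"
      "set_integrable lebesgue S (\<lambda>x. M x * w x)" "set_integrable lebesgue S (\<lambda>x. M x * (v x)\<^sup>2)"
      "set_integrable lebesgue S (\<lambda>x. M x * (w x)\<^sup>2)" "set_integrable lebesgue S (\<lambda>x. M x * w x * v x)"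
    by (intro int continuous_intros M cont)+
  \<comment> \<open>\<open>A\<close> and \<open>B\<close> are the new and old energies,
    \<open>C\<close> is the dissipation without the factor \<open>D\<close>, and \<open>m\<close> is
    the integral of \<open>M\<close>. The masses \<open>P\<close> and \<open>Q\<close>
    follow.\<close>
  define A B C m where "A = (LINT x:S|lebesgue. M x * (v x)\<^sup>2)"
    and "B = (LINT x:S|lebesgue. M x * (w x)\<^sup>2)"
    and "C = (LINT x:S|lebesgue. M x * (norm (gradient v x))\<^sup>2)"
    and "m = (LINT x:S|lebesgue. M x)"
  define P Q where "P = (LINT x:S|lebesgue. M x * v x)" and "Q = (LINT x:S|lebesgue. M x * w x)"

  \<comment> \<open>The scheme tested with \<open>v\<close>, the new iterate itself; the convection
    term vanishes.\<close>
  have "A + \<Delta>t * (D * C) = (LINT x:S|lebesgue. M x * w x * v x)"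
  proof -
    have "L2_inner S (\<lambda>x. v x *\<^sub>R u x) (gradient v) = 0"
      unfolding S_def v_def
      by (rule convection_skew[OF assms(2) assms(9) assms(10) assms(11) assms(12) assms(14)])
    moreover have "L2_inner S (\<lambda>x. (D * M x) *\<^sub>R gradient v x) (gradient v) = D * C"
      by (simp add: L2_inner_def C_def power2_norm_eq_inner mult.assoc)
    moreover have "L2_inner S (\<lambda>x. M x * v x) v = A"
      by (simp add: L2_inner_def A_def power2_eq_square mult.assoc)
    ultimately show ?thesis
      using scheme[of v n] assms(14)[of "Suc n"]
      by (simp add: L2_inner_def S_def v_def w_def)
  qed
  \<comment> \<open>Young's inequality with weight \<open>M\<close>. Moving half of \<open>A\<close>
    to the left afterwards produces the factor 2 in the dissipation.\<close>
  also have "\<dots> \<le> (LINT x:S|lebesgue. (M x * (v x)\<^sup>2 + M x * (w x)\<^sup>2) / 2)"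
  proof (rule set_integral_mono)
    fix x assume "x \<in> S"
    then have "0 \<le> M x * (v x - w x)\<^sup>2" using Mpos[of x] by simp
    then show "M x * w x * v x \<le> (M x * (v x)\<^sup>2 + M x * (w x)\<^sup>2) / 2"
      by (simp add: power2_eq_square algebra_simps)
  qed (use ints in auto)
  also have "\<dots> = (A + B) / 2"
    by (simp add: ints A_def B_def)
  finally have energy: "A - B \<le> \<Delta>t * (- 2 * D * C)" by (simp add: algebra_simps)

  \<comment> \<open>With the test function 1 both gradient terms drop out, leaving conservation of
    mass.\<close>
  have PQ: "P = Q"
    using scheme[OF one_in_fe_space, of n]
    by (simp add: L2_inner_def gradient_const P_def Q_def S_def v_def w_def)

  have sq: "(LINT x:S|lebesgue. (\<rho> k x)\<^sup>2 / M x) = (LINT x:S|lebesgue. M x * (g k x)\<^sup>2)" for k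
    using S(1) Mpos
    by (intro set_lebesgue_integral_cong) (auto simp: \<rho> power2_eq_square less_imp_neq[symmetric])
  have A: "(LINT x:S|lebesgue. (\<rho> (Suc n) x)\<^sup>2 / M x) = A"
    and B: "(LINT x:S|lebesgue. (\<rho> n x)\<^sup>2 / M x) = B"
    by (simp_all add: sq A_def B_def v_def w_def)
  \<comment> \<open>Since \<open>\<rho> = M g\<close>, the shifted energy density is
    \<open>M (g - 1)\<^sup>2\<close>; expanding it yields the energy, the mass and
    \<open>m\<close>.\<close>
  have sq': "(LINT x:S|lebesgue. (\<rho> k x - M x)\<^sup>2 / M x) =
      (LINT x:S|lebesgue. M x * (g k x)\<^sup>2 - 2 * (M x * g k x) + M x)" for k
  proof (intro set_lebesgue_integral_cong S(1) allI impI)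
    fix x assume "x \<in> S"
    then have "M x \<noteq> 0" using Mpos[of x] by simp
    then show "(\<rho> k x - M x)\<^sup>2 / M x = M x * (g k x)\<^sup>2 - 2 * (M x * g k x) + M x"
      by (simp add: \<rho> power2_eq_square field_simps)
  qed
  have A': "(LINT x:S|lebesgue. (\<rho> (Suc n) x - M x)\<^sup>2 / M x) = A - 2 * P + m"
    and B': "(LINT x:S|lebesgue. (\<rho> n x - M x)\<^sup>2 / M x) = B - 2 * Q + m"
    unfolding sq' using ints by (simp_all add: A_def B_def P_def Q_def m_def v_def w_def)
  \<comment> \<open>On the open box \<open>M\<close> is positive, so the quotient equals
    \<open>v\<close> near each point and has the same gradient.\<close>
  have C: "(LINT x:S|lebesgue. M x * (norm (gradient (\<lambda>y. \<rho> (Suc n) y / M y) x))\<^sup>2) = C"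
    unfolding C_def
  proof (intro set_lebesgue_integral_cong S(1) allI impI)
    fix x assume x: "x \<in> S"
    have "\<rho> (Suc n) y / M y = v y" if "y \<in> S" for y
      using Mpos[OF that] by (simp add: \<rho> v_def)
    then show "M x * (norm (gradient (\<lambda>y. \<rho> (Suc n) y / M y) x))\<^sup>2 = M x * (norm (gradient v x))\<^sup>2"
      using gradient_cong_open[OF S(2) x] by metis
  qed
  have "1 / \<Delta>t * A - 1 / \<Delta>t * B \<le> - 2 * D * C"
    using energy assms(4) by (simp add: field_simps)
  \<comment> \<open>Equal masses cancel, so both inequalities have the same left-hand side.\<close>
  moreover have "1 / \<Delta>t * (A - 2 * P + m) - 1 / \<Delta>t * (B - 2 * Q + m) = 1 / \<Delta>t * A - 1 / \<Delta>t * B"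
    unfolding PQ by (simp add: add_divide_distrib diff_divide_distrib)
  ultimately show "1 / \<Delta>t * (LINT x:box a b|lebesgue. (\<rho> (Suc n) x)\<^sup>2 / M x)
      - 1 / \<Delta>t * (LINT x:box a b|lebesgue. (\<rho> n x)\<^sup>2 / M x)
      \<le> - 2 * D * (LINT x:box a b|lebesgue.
            M x * (norm (gradient (\<lambda>y. \<rho> (Suc n) y / M y) x))\<^sup>2)
    \<and>
    1 / \<Delta>t * (LINT x:box a b|lebesgue. (\<rho> (Suc n) x - M x)\<^sup>2 / M x)
      - 1 / \<Delta>t * (LINT x:box a b|lebesgue. (\<rho> n x - M x)\<^sup>2 / M x)
      \<le> - 2 * D * (LINT x:box a b|lebesgue.
            M x * (norm (gradient (\<lambda>y. \<rho> (Suc n) y / M y) x))\<^sup>2)"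
    using A B C A' B' unfolding S_def by simp
qed

end
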